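(* Let $E:\ a_1x_1+a_2x_2+a_3x_3+a_4x_4=0$ be an invariant homogeneous linear equation in $4$ variables, i.e. $a_1,a_2,a_3,a_4$ are nonzero integers with $a_1+a_2+a_3+a_4=0$. If $E$ is sparse, then $E$ is abundant. More precisely, if $C>0$ is such that $R_E(\varepsilon)\le \varepsilon^{-C}$ (for all sufficiently small $\varepsilon>0$), then $R^*_E(\varepsilon)\ge \frac12\varepsilon^{8C}$ for all sufficiently small $\varepsilon>0$.
   Context: For $n\in\mathbb{N}$ write $[n]=\{1,\dots,n\}$. For $0<\varepsilon\le 1$, $R_E(\varepsilon)$ denotes the smallest integer $R$ such that for every $n\ge R$, every set $S\subseteq[n]$ with $|S|=\varepsilon n$ (equivalently, $|S|\ge \varepsilon n$) contains a solution $(x_1,x_2,x_3,x_4)$ of $E$ with $x_1,x_2,x_3,x_4$ pairwise distinct elements of $S$. The equation $E$ is called sparse if there is a constant $C=C(E)$ with $R_E(\varepsilon)\le \varepsilon^{-C}$ for all sufficiently small $\varepsilon>0$. For an equation in $k$ variables, $R^*_E(\varepsilon)$ denotes the largest number such that every $S\subseteq[n]$ with $|S|=\varepsilon n$ contains at least $(R^*_E(\varepsilon)-o_n(1))\cdot n^{k-1}$ solutions of $E$ (tuples of elements of $S$ satisfying $E$), where $o_n(1)$ is a quantity tending to $0$ as $n\to\infty$; equivalently $R^*_E(\varepsilon)=\liminf_{n\to\infty}\min_{S\subseteq[n],\,|S|\ge\varepsilon n} \#\{\text{solutions of } E \text{ in } S\}/n^{k-1}$. Here $k=4$. The equation $E$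 is called abundant if there is a constant $C'=C'(E)$ with $R^*_E(\varepsilon)\ge\varepsilon^{C'}$ for all sufficiently small $\varepsilon>0$. *)

theory Defs
  imports "HOL-Analysis.Analysis"
begin

definition is_sol :: "int \<Rightarrow> int \<Rightarrow> int \<Rightarrow> int \<Rightarrow> nat \<Rightarrow> nat \<Rightarrow> nat \<Rightarrow> nat \<Rightarrow> bool" where
  "is_sol a1 a2 a3 a4 x1 x2 x3 x4 \<longleftrightarrow>
     a1 * int x1 + a2 * int x2 + a3 * int x3 + a4 * int x4 = 0"

definition has_distinct_sol :: "int \<Rightarrow> int \<Rightarrow> int \<Rightarrow> int \<Rightarrow> nat set \<Rightarrow> bool" where
  "has_distinct_sol a1 a2 a3 a4 S \<longleftrightarrow>
     (\<exists>x1\<in>S. \<exists>x2\<in>S. \<exists>x3\<in>S. \<exists>x4\<in>S.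
        x1 \<noteq> x2 \<and> x1 \<noteq> x3 \<and> x1 \<noteq> x4 \<and> x2 \<noteq> x3 \<and> x2 \<noteq> x4 \<and> x3 \<noteq> x4 \<and>
        is_sol a1 a2 a3 a4 x1 x2 x3 x4)"

definition R_good :: "int \<Rightarrow> int \<Rightarrow> int \<Rightarrow> int \<Rightarrow> real \<Rightarrow> nat \<Rightarrow> bool" where
  "R_good a1 a2 a3 a4 \<epsilon> R \<longleftrightarrow>
     (\<forall>n\<ge>R. \<forall>S. S \<subseteq> {1..n} \<and> real (card S) \<ge> \<epsilon> * real n \<longrightarrow> has_distinct_sol a1 a2 a3 a4 S)"

text \<open>R_E(eps): the smallest admissible R (meaningful only when one exists).\<close>
definition R_E :: "int \<Rightarrow> int \<Rightarrow> int \<Rightarrow> int \<Rightarrow> real \<Rightarrow> nat" where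
  "R_E a1 a2 a3 a4 \<epsilon> = (LEAST R. R_good a1 a2 a3 a4 \<epsilon> R)"

definition sols :: "int \<Rightarrow> int \<Rightarrow> int \<Rightarrow> int \<Rightarrow> nat set \<Rightarrow> (nat \<times> nat \<times> nat \<times> nat) set" where
  "sols a1 a2 a3 a4 S = {(x1, x2, x3, x4). x1 \<in> S \<and> x2 \<in> S \<and> x3 \<in> S \<and> x4 \<in> S \<and>
                            is_sol a1 a2 a3 a4 x1 x2 x3 x4}"

definition min_sol_density :: "int \<Rightarrow> int \<Rightarrow> int \<Rightarrow> int \<Rightarrow> real \<Rightarrow> nat \<Rightarrow> real" where
  "min_sol_density a1 a2 a3 a4 \<epsilon> n =
     Min ((\<lambda>S. real (card (sols a1 a2 a3 a4 S)) / real n ^ 3) `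
          {S. S \<subseteq> {1..n} \<and> real (card S) \<ge> \<epsilon> * real n})"

definition R_star_E :: "int \<Rightarrow> int \<Rightarrow> int \<Rightarrow> int \<Rightarrow> real \<Rightarrow> ereal" where
  "R_star_E a1 a2 a3 a4 \<epsilon> = liminf (\<lambda>n. ereal (min_sol_density a1 a2 a3 a4 \<epsilon> n))"

end

theory Submission
  imports Defs
begin

text \<open>
  Write \<open>r\<^sub>1\<^sub>2(t)\<close> and \<open>r\<^sub>3\<^sub>4(t)\<close> for the number of pairs in \<open>S\<close> with \<open>a1 x1 + a2 x2 = t\<close> and
  \<open>a3 x3 + a4 x4 = t\<close>, so that the number of solutions is the sum of \<open>r\<^sub>1\<^sub>2(t) r\<^sub>3\<^sub>4(-t)\<close> over \<open>t\<close>.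
  With \<open>h = c \<epsilon> n / m\<close>, only \<open>O(n h)\<close> pairs of \<open>S\<close> have a sum attained fewer than \<open>h\<close> times.
  Embed \<open>[n]\<close> in \<open>\<int>/N\<close> with \<open>N = O(n)\<close> so large that no solution wraps around, and pull \<open>S\<close> back
  along a random map \<open>i \<mapsto> c + d i\<close> from \<open>[m]\<close>. Deleting an endpoint of each unpopular pair
  leaves, for a positive proportion \<open>\<theta> \<approx> \<epsilon>\<close> of all \<open>(c, d)\<close>, a set of density \<open>\<theta>\<close> in \<open>[m]\<close>.
  If \<open>m \<ge> R\<^sub>E(\<theta>)\<close>, this set contains a solution, whose image yields a \<open>t\<close> with
  \<open>r\<^sub>1\<^sub>2(t) \<ge> h\<close> and \<open>r\<^sub>3\<^sub>4(-t) \<ge> h\<close>. Each \<open>t\<close> arises from at most \<open>m\<^sup>2 N\<close> pairs \<open>(c, d)\<close>, so there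
  are at least \<open>\<theta> n / m\<^sup>2\<close> such \<open>t\<close>, and at least a constant times \<open>\<epsilon>\<^sup>3 m\<^sup>-\<^sup>4 n\<^sup>3\<close> solutions.
  Taking \<open>m\<close> of order \<open>\<epsilon>\<close> to the power \<open>-C\<close> gives the exponent \<open>4 C + 3\<close>, which beats \<open>8 C\<close> because \<open>C > 1\<close>:
  a singleton has density \<open>1/n\<close> in \<open>[n]\<close> and contains no solution in distinct elements.
\<close>

section \<open>Solutions grouped by the value of a two-variable form\<close>

definition pair_fibre :: "int \<Rightarrow> int \<Rightarrow> nat set \<Rightarrow> int \<Rightarrow> (nat \<times> nat) set" where
  "pair_fibre a b S t = {(x, y) \<in> S \<times> S. a * int x + b * int y = t}"

lemma finite_pair_fibre: "finite S \<Longrightarrow> finite (pair_fibre a b S t)"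
  unfolding pair_fibre_def by (rule finite_subset[of _ "S \<times> S"]) auto

lemma finite_sols: "finite S \<Longrightarrow> finite (sols a1 a2 a3 a4 S)"
  unfolding sols_def by (rule finite_subset[of _ "S \<times> S \<times> S \<times> S"]) auto

text \<open>A pair from the fibre over \<open>t\<close> and one from the fibre over
  \<open>- t\<close> combine to a solution. No solution is counted twice, since \<open>t\<close> is
  recovered from its first two entries.\<close>

lemma card_sols_ge:
  fixes h :: real
  assumes fin: "finite S" "finite T" and h: "0 \<le> h"
    and pop: "\<And>t. t \<in> T \<Longrightarrow> h \<le> card (pair_fibre a1 a2 S t)"
      "\<And>t. t \<in> T \<Longrightarrow> h \<le> card (pair_fibre a3 a4 S (- t))"
  shows "real (card T) * h\<^sup>2 \<le> card (sols a1 a2 a3 a4 S)"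
proof -
  let ?A = "SIGMA t:T. pair_fibre a1 a2 S t \<times> pair_fibre a3 a4 S (- t)"
  let ?f = "\<lambda>(t :: int, (x1, x2), x3, x4). (x1 :: nat, x2 :: nat, x3 :: nat, x4 :: nat)"
  have "real (card T) * h\<^sup>2 = (\<Sum>t\<in>T. h * h)"
    by (simp add: power2_eq_square)
  also have "\<dots> \<le> (\<Sum>t\<in>T. real (card (pair_fibre a1 a2 S t)) * card (pair_fibre a3 a4 S (- t)))"
    using pop h by (intro sum_mono mult_mono) auto
  also have "\<dots> = card ?A"
    using fin by (subst card_SigmaI) (auto simp: finite_pair_fibre card_cartesian_product)
  also have "card ?A \<le> card (sols a1 a2 a3 a4 S)"
  proof (rule card_inj_on_le)
    show "inj_on ?f ?A"
      by (auto simp: inj_on_def pair_fibre_def)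
    show "?f ` ?A \<subseteq> sols a1 a2 a3 a4 S"
      by (auto simp: pair_fibre_def sols_def is_sol_def)
  qed (simp add: fin finite_sols)
  finally show ?thesis by simp
qed

lemma abs_linear_form_le:
  fixes a b :: int
  assumes "x \<le> n" "y \<le> n"
  shows "\<bar>a * int x + b * int y\<bar> \<le> (\<bar>a\<bar> + \<bar>b\<bar>) * int n"
proof -
  have "\<bar>a * int x + b * int y\<bar> \<le> \<bar>a\<bar> * int x + \<bar>b\<bar> * int y"
    by (rule order_trans[OF abs_triangle_ineq]) (simp add: abs_mult)
  also have "\<dots> \<le> \<bar>a\<bar> * int n + \<bar>b\<bar> * int n"
    using assms by (intro add_mono mult_left_mono) auto
  finally show ?thesis by (simp add: algebra_simps)
qed

section \<open>Pairs with a rarely attained sum\<close>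

definition unpopular_pairs :: "int \<Rightarrow> int \<Rightarrow> nat set \<Rightarrow> real \<Rightarrow> (nat \<times> nat) set" where
  "unpopular_pairs a b S h =
     {(x, y) \<in> S \<times> S. real (card (pair_fibre a b S (a * int x + b * int y))) < h}"

text \<open>The form takes at most \<open>2 * K * n + 1\<close> values on the pairs, and each
  unpopular value accounts for fewer than \<open>h\<close> of them.\<close>

lemma card_unpopular_pairs_le:
  assumes S: "S \<subseteq> {1..n}" and h: "0 \<le> h" and K: "\<bar>a\<bar> + \<bar>b\<bar> \<le> int K"
  shows "card (unpopular_pairs a b S h) \<le> (2 * real K * n + 1) * h"
proof -
  let ?T = "{t \<in> {- (int K * int n)..int K * int n}. card (pair_fibre a b S t) < h}"
  have fin: "finite S" using S finite_subset by blast
  have finT: "finite ?T"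
    by (rule finite_subset[of _ "{- (int K * int n)..int K * int n}"]) auto
  have "unpopular_pairs a b S h \<subseteq> (\<Union>t\<in>?T. pair_fibre a b S t)"
  proof
    fix p assume p: "p \<in> unpopular_pairs a b S h"
    then obtain x y where xy: "p = (x, y)" "x \<in> S" "y \<in> S"
      "card (pair_fibre a b S (a * int x + b * int y)) < h"
      by (auto simp: unpopular_pairs_def)
    have "\<bar>a * int x + b * int y\<bar> \<le> (\<bar>a\<bar> + \<bar>b\<bar>) * int n"
      using xy S by (intro abs_linear_form_le) auto
    also have "\<dots> \<le> int K * int n"
      using K by (intro mult_right_mono) auto
    finally have "a * int x + b * int y \<in> ?T" using xy by auto
    then show "p \<in> (\<Union>t\<in>?T. pair_fibre a b S t)"
      using xy by (auto simp: pair_fibre_def intro!: UN_I)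
  qed
  then have "card (unpopular_pairs a b S h) \<le> card (\<Union>t\<in>?T. pair_fibre a b S t)"
    using fin by (intro card_mono finite_UN_I finT finite_pair_fibre)
  also have "\<dots> \<le> (\<Sum>t\<in>?T. card (pair_fibre a b S t))"
    by (rule card_UN_le[OF finT])
  finally have "real (card (unpopular_pairs a b S h)) \<le> real (\<Sum>t\<in>?T. card (pair_fibre a b S t))"
    by (rule of_nat_mono)
  also have "\<dots> = (\<Sum>t\<in>?T. real (card (pair_fibre a b S t)))"
    by (rule of_nat_sum)
  also have "\<dots> \<le> (\<Sum>t\<in>?T. h)"
    by (intro sum_mono) auto
  also have "\<dots> = card ?T * h" by simp
  also have "\<dots> \<le> card {- (int K * int n)..int K * int n} * h"
    using h by (intro mult_right_mono of_nat_mono card_mono) auto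
  also have "\<dots> = (2 * real K * n + 1) * h"
    by (simp add: algebra_simps)
  finally show ?thesis .
qed

section \<open>Affine maps modulo \<open>N\<close>\<close>

text \<open>Serves all injectivity claims about affine maps: a factor coprime to \<open>N\<close>
  cancels, and congruent numbers below \<open>N\<close> coincide.\<close>

lemma residue_eqI:
  fixes c c' N :: nat
  assumes "c < N" "c' < N" "int N dvd z * (int c - int c')" "coprime z (int N)"
  shows "c = c'"
proof -
  have "int N dvd int c - int c'"
    using assms by (meson coprime_commute coprime_dvd_mult_right_iff)
  then have "int c mod int N = int c' mod int N" by (simp add: mod_eq_dvd_iff)
  then show ?thesis using assms by simp
qed

text \<open>The slope \<open>d = 0\<close> is allowed, so a map may be constant. This is harmless,
  because \<open>sols\<close> admits solutions with repeated entries.\<close>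

definition affine_mod :: "nat \<Rightarrow> nat \<Rightarrow> nat \<Rightarrow> nat \<Rightarrow> nat" where
  "affine_mod N c d i = (c + d * i) mod N"

lemma dvd_affine_mod_diff: "int N dvd int (affine_mod N c d i) - (int c + int d * int i)"
  unfolding affine_mod_def
  by (simp add: of_nat_mod flip: mod_eq_dvd_iff)

lemma affine_mod_eq_dvd:
  assumes "affine_mod N c d i = affine_mod N c' d' i"
  shows "int N dvd (int c - int c') + (int d - int d') * int i"
proof -
  have "int N dvd (int (affine_mod N c' d' i) - (int c' + int d' * int i))
      - (int (affine_mod N c d i) - (int c + int d * int i))"
    by (intro dvd_diff dvd_affine_mod_diff)
  then show ?thesis using assms by (simp add: algebra_simps)
qed

lemma dvd_linear_form_affine_mod:
  "int N dvd (a * int (affine_mod N c d i) + b * int (affine_mod N c d j))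
     - ((a + b) * int c + (a * int i + b * int j) * int d)"
proof -
  have "int N dvd a * (int (affine_mod N c d i) - (int c + int d * int i))
     + b * (int (affine_mod N c d j) - (int c + int d * int j))"
    by (intro dvd_add dvd_mult dvd_affine_mod_diff)
  then show ?thesis by (simp add: algebra_simps)
qed

text \<open>For fixed \<open>d\<close> and \<open>i\<close>, the shift by \<open>d * i\<close>
  permutes the residues, so a random map sends \<open>i\<close> to a uniformly distributed
  point.\<close>

lemma card_affine_mod_point:
  assumes S: "S \<subseteq> {..<N}" and N: "N > 0"
  shows "card {(c, d) \<in> {..<N} \<times> {..<N}. affine_mod N c d i \<in> S} = N * card S"
proof -
  let ?A = "{(c, d) \<in> {..<N} \<times> {..<N}. affine_mod N c d i \<in> S}"
  have "bij_betw (\<lambda>(c, d). (affine_mod N c d i, d)) ?A (S \<times> {..<N})"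
    unfolding bij_betw_def
  proof
    show "inj_on (\<lambda>(c, d). (affine_mod N c d i, d)) ?A"
    proof (rule inj_onI, clarsimp)
      fix c c' d
      assume "c < N" "c' < N" "affine_mod N c d i = affine_mod N c' d i"
      then show "c = c'"
        using affine_mod_eq_dvd[of N c d i c' d] by (intro residue_eqI[of c N c' 1]) auto
    qed
    show "(\<lambda>(c, d). (affine_mod N c d i, d)) ` ?A = S \<times> {..<N}" (is "?L = ?R")
    proof
      show "?L \<subseteq> ?R" by auto
      show "?R \<subseteq> ?L"
      proof
        fix p assume "p \<in> S \<times> {..<N}"
        then obtain s d where p: "p = (s, d)" and sd: "s \<in> S" "d \<in> {..<N}" by blast
        \<comment> \<open>This solves \<open>c + d * i = s\<close> modulo \<open>N\<close>, over the
          integers because the difference may be negative.\<close>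
        define c where "c = nat ((int s - int d * int i) mod int N)"
        have c: "int c = (int s - int d * int i) mod int N"
          using N by (simp add: c_def)
        then have cN: "c < N"
          using N by (metis of_nat_0_less_iff of_nat_less_iff pos_mod_bound)
        have "int ((c + d * i) mod N) = int s mod int N"
          by (simp add: of_nat_mod c mod_simps)
        then have "affine_mod N c d i = s"
          using S sd by (auto simp: affine_mod_def subset_iff simp flip: of_nat_mod)
        then show "p \<in> ?L" using p sd cN by (force intro!: image_eqI[of _ _ "(c, d)"])
      qed
    qed
  qed
  then have "card ?A = card (S \<times> {..<N})" by (rule bij_betw_same_card)
  then show ?thesis by (simp add: card_cartesian_product)
qed

text \<open>An affine map is determined by its values at two points whose difference is a unit
  modulo \<open>N\<close>.\<close>

lemma card_affine_mod_pair_le: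
  assumes "finite B" and cop: "coprime (int i - int j) (int N)"
  shows "card {(c, d) \<in> {..<N} \<times> {..<N}. (affine_mod N c d i, affine_mod N c d j) \<in> B} \<le> card B"
proof (rule card_inj_on_le)
  let ?f = "\<lambda>(c, d). (affine_mod N c d i, affine_mod N c d j)"
  show "inj_on ?f {(c, d) \<in> {..<N} \<times> {..<N}. (affine_mod N c d i, affine_mod N c d j) \<in> B}"
  proof (rule inj_onI, clarsimp)
    fix c d c' d'
    assume lt: "c < N" "d < N" "c' < N" "d' < N"
      and i: "affine_mod N c d i = affine_mod N c' d' i"
      and j: "affine_mod N c d j = affine_mod N c' d' j"
    have "int N dvd ((int c - int c') + (int d - int d') * int i)
        - ((int c - int c') + (int d - int d') * int j)"
      using i j by (intro dvd_diff affine_mod_eq_dvd)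
    then have "int N dvd (int i - int j) * (int d - int d')"
      by (simp add: algebra_simps)
    then have d: "d = d'" using lt cop by (intro residue_eqI[of d N d' "int i - int j"])
    moreover have "c = c'"
      using lt affine_mod_eq_dvd[OF i] d by (intro residue_eqI[of c N c' 1]) auto
    ultimately show "c = c' \<and> d = d'" by simp
  qed
qed (use assms in auto)

text \<open>If \<alpha> is a unit, then \<open>d\<close> determines \<open>c\<close>; if \<alpha>
  vanishes and \<beta> is a unit, then \<open>c\<close> determines \<open>d\<close>. The second case
  is for equations with \<open>a1 + a2 = 0\<close>.\<close>

lemma card_linear_form_fibre_le:
  fixes t :: int
  assumes "coprime \<alpha> (int N) \<or> \<alpha> = 0 \<and> coprime \<beta> (int N)"
  shows "card {(c, d) \<in> {..<N} \<times> {..<N}. int N dvd t - (\<alpha> * int c + \<beta> * int d)} \<le> N"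
    (is "card ?A \<le> N")
proof -
  have diff: "int N dvd \<alpha> * (int c - int c') + \<beta> * (int d - int d')"
    if "int N dvd t - (\<alpha> * int c + \<beta> * int d)" "int N dvd t - (\<alpha> * int c' + \<beta> * int d')"
    for c c' d d'
    using dvd_diff[OF that(2) that(1)] by (simp add: algebra_simps)
  have "inj_on snd ?A \<or> inj_on fst ?A"
  proof (cases "coprime \<alpha> (int N)")
    case True
    have "inj_on snd ?A"
    proof (rule inj_onI, clarsimp)
      fix c c' d
      assume "c < N" "c' < N" "int N dvd t - (\<alpha> * int c + \<beta> * int d)"
        "int N dvd t - (\<alpha> * int c' + \<beta> * int d)"
      then show "c = c'" using True diff[of c d c' d] by (intro residue_eqI[of c N c' \<alpha>]) auto
    qed
    then show ?thesis ..
  next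
    case False
    have "inj_on fst ?A"
    proof (rule inj_onI, clarsimp)
      fix c d d'
      assume "d < N" "d' < N" "int N dvd t - (\<alpha> * int c + \<beta> * int d)"
        "int N dvd t - (\<alpha> * int c + \<beta> * int d')"
      then show "d = d'" using False assms diff[of c d c d'] by (intro residue_eqI[of d N d' \<beta>]) auto
    qed
    then show ?thesis ..
  qed
  then have "card ?A \<le> card {..<N}"
    by (elim disjE; intro card_inj_on_le) auto
  then show ?thesis by simp
qed

section \<open>Averaging and the choice of modulus\<close>

text \<open>A reverse Markov inequality: small values contribute at most half of the required sum,
  and each large one at most \<open>M\<close>. There is no lower bound on \<open>f\<close>, which
  can be negative in the application.\<close>

lemma card_large_values_ge:
  fixes f :: "'a \<Rightarrow> real"
  assumes "finite A" "\<And>x. x \<in> A \<Longrightarrow> f x \<le> M" "0 < M"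
    and "2 * \<theta> * M * card A \<le> sum f A" "0 \<le> \<theta>"
  shows "\<theta> * card A \<le> card {x \<in> A. \<theta> * M \<le> f x}"
proof -
  define G where "G = {x \<in> A. \<theta> * M \<le> f x}"
  have "f x \<le> \<theta> * M + (if x \<in> G then M else 0)" if "x \<in> A" for x
  proof -
    have "0 \<le> \<theta> * M" using assms by simp
    then show ?thesis using assms(2)[OF that] that unfolding G_def by auto
  qed
  then have "sum f A \<le> (\<Sum>x\<in>A. \<theta> * M + (if x \<in> G then M else 0))"
    by (rule sum_mono)
  also have "\<dots> = card A * (\<theta> * M) + (\<Sum>x\<in>A. if x \<in> G then M else 0)"
    by (simp add: sum.distrib)
  also have "(\<Sum>x\<in>A. if x \<in> G then M else 0) = (\<Sum>x\<in>A \<inter> G. M)"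
    using assms(1) by (rule sum.inter_restrict[symmetric])
  also have "A \<inter> G = G" by (auto simp: G_def)
  finally have "M * (\<theta> * card A) \<le> M * card G"
    using assms(4) by (simp add: mult_ac)
  then show ?thesis using \<open>0 < M\<close> unfolding G_def by (simp only: mult_le_cancel_left_pos)
qed

text \<open>A modulus of this form does the work of a prime modulus, without Bertrand's postulate.\<close>

lemma coprime_Suc_multiple_fact:
  fixes z :: int
  assumes "z \<noteq> 0" "\<bar>z\<bar> \<le> int k"
  shows "coprime z (int (1 + fact k * q))"
proof (rule coprimeI)
  fix g assume g: "g dvd z" "g dvd int (1 + fact k * q)"
  have "nat \<bar>z\<bar> dvd fact k"
    using assms by (intro dvd_fact) auto
  then have "z dvd int (fact k)"
    by (simp add: int_dvd_int_iff[symmetric] del: of_nat_fact)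
  then have "g dvd int (fact k) * int q" using g(1) by (metis dvd_mult2 dvd_trans)
  then have "g dvd int (1 + fact k * q) - int (fact k) * int q"
    using g(2) by (rule dvd_diff[rotated])
  then show "is_unit g" by simp
qed

section \<open>Popular values found through random affine copies\<close>

text \<open>The bound has the form \<open>card T * h\<^sup>2\<close>, with at least
  \<open>\<theta> * n / m\<^sup>2\<close> popular values in \<open>T\<close>. The assumption
  \<open>fact (m + K) \<le> n\<close> keeps the modulus linear in \<open>n\<close>.\<close>

lemma card_sols_ge_of_R_good:
  fixes a1 a2 a3 a4 :: int and \<epsilon> :: real and K m n :: nat
  assumes a1: "a1 \<noteq> 0" and sum0: "a1 + a2 + a3 + a4 = 0"
    and K: "\<bar>a1\<bar> + \<bar>a2\<bar> + \<bar>a3\<bar> + \<bar>a4\<bar> \<le> int K"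
    and \<epsilon>: "0 < \<epsilon>" and m: "1 \<le> m"
    and good: "R_good a1 a2 a3 a4 (\<epsilon> / (4 * (K + 2))) m"
    and n: "fact (m + K) \<le> n"
    and S: "S \<subseteq> {1..n}" "\<epsilon> * n \<le> card S"
  shows "\<epsilon> / (4 * (K + 2)) * n / m\<^sup>2 * (\<epsilon> * n / (12 * K * m))\<^sup>2 \<le> card (sols a1 a2 a3 a4 S)"
proof -
  define M :: nat where "M = fact (m + K)"
  \<comment> \<open>Being 1 more than a multiple of \<open>fact (m + K)\<close> makes every nonzero
    integer of size at most \<open>m + K\<close> a unit modulo \<open>N\<close>. The inner
    \<open>+ 1\<close> forces \<open>K * n < N\<close>, which excludes wraparound.\<close>
  define N where "N = 1 + M * (K * n div M + 1)"
  \<comment> \<open>Deletions cost one factor 2, averaging another, and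
    \<open>N \<le> (K + 2) * n\<close> gives the rest.\<close>
  define \<theta> where "\<theta> = \<epsilon> / (4 * (K + 2))"
  \<comment> \<open>With this \<open>h\<close>, the bound \<open>m\<^sup>2 * (6 * K * n * h)\<close>
    on the total number of deletions equals \<open>m * n\<^sup>2 * \<epsilon> / 2\<close>, at most
    half of the total size of the pullbacks.\<close>
  define h where "h = \<epsilon> * n / (12 * K * m)"
  define P where "P = {..<N} \<times> {..<N}"
  define B where "B = unpopular_pairs a1 a2 S h \<union> unpopular_pairs a3 a4 S h"
  define I where "I = (\<lambda>(c, d). {i \<in> {1..m}. affine_mod N c d i \<in> S})"
  \<comment> \<open>The diagonal is left out because \<open>i - j\<close> must be a unit; a solution
    in distinct elements uses only off-diagonal pairs.\<close>
  define E where "E = (\<lambda>(c, d). {(i, j) \<in> {1..m} \<times> {1..m}. i \<noteq> j \<and>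
      (affine_mod N c d i, affine_mod N c d j) \<in> B})"
  define T where "T = {t \<in> {- (int K * int n)..int K * int n}.
      h \<le> card (pair_fibre a1 a2 S t) \<and> h \<le> card (pair_fibre a3 a4 S (- t))}"

  have K1: "1 \<le> K" using a1 K by linarith
  have M1: "1 \<le> M" unfolding M_def by (rule fact_ge_1)
  have n1: "1 \<le> n" using n M1 unfolding M_def by linarith
  have Kn: "K * n < N"
  proof -
    have "K * n < M * (K * n div M + 1)"
      using M1 by (metis Suc_eq_plus1 dividend_less_times_div less_le_trans mult_Suc_right add.commute zero_less_one)
    then show ?thesis by (simp add: N_def)
  qed
  have N_le: "N \<le> (K + 2) * n"
  proof -
    have "M * (K * n div M) \<le> K * n" by (rule times_div_less_eq_dividend)
    moreover have "M \<le> n" using n by (simp add: M_def)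
    ultimately have "1 + (M * (K * n div M) + M) \<le> n + (K * n + n)" using n1 by linarith
    then show ?thesis unfolding N_def by (simp only: distrib_left distrib_right)
  qed
  have nN: "n < N" using Kn K1 by (metis le_less_trans mult_le_mono1 nat_mult_1)
  have N0: "0 < N" using nN by simp
  have \<theta>: "0 < \<theta>" using \<epsilon> by (simp add: \<theta>_def)
  have h: "0 \<le> h" using \<epsilon> by (simp add: h_def)
  have finS: "finite S" using S finite_subset by blast
  have finT: "finite T"
    by (rule finite_subset[of _ "{- (int K * int n)..int K * int n}"]) (auto simp: T_def)
  have SN: "S \<subseteq> {..<N}" using S nN by auto
  have B_sub: "B \<subseteq> S \<times> S" by (auto simp: B_def unpopular_pairs_def)
  have finB: "finite B" using B_sub finS finite_subset by blast
  have finP: "finite P" by (simp add: P_def)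
  have cop: "coprime z (int N)" if "z \<noteq> 0" "\<bar>z\<bar> \<le> int (m + K)" for z
    unfolding N_def M_def using that by (rule coprime_Suc_multiple_fact)

  have card_B: "card B \<le> 6 * real K * n * h"
  proof -
    have "card B \<le> card (unpopular_pairs a1 a2 S h) + card (unpopular_pairs a3 a4 S h)"
      unfolding B_def by (rule card_Un_le)
    then have "real (card B) \<le> real (card (unpopular_pairs a1 a2 S h)) + card (unpopular_pairs a3 a4 S h)"
      by linarith
    also have "\<dots> \<le> (2 * real K * n + 1) * h + (2 * real K * n + 1) * h"
      using S(1) h K by (intro add_mono card_unpopular_pairs_le) auto
    also have "\<dots> \<le> (3 * real K * n) * h + (3 * real K * n) * h"
    proof -
      have "1 * 1 \<le> real K * real n" using K1 n1 by (intro mult_mono) auto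
      then show ?thesis using h by (intro add_mono mult_right_mono) auto
    qed
    finally show ?thesis by (simp add: mult_ac)
  qed

  \<comment> \<open>Double counting: exchange the sum over maps with the sum over indices.\<close>
  have sum_I: "(\<Sum>p\<in>P. card (I p)) = m * (N * card S)"
  proof -
    have "(\<Sum>p\<in>P. card (I p)) = (\<Sum>p\<in>P. \<Sum>i\<in>{1..m}. if affine_mod N (fst p) (snd p) i \<in> S then 1 else 0)"
      by (intro sum.cong refl) (auto simp: I_def sum.If_cases Int_def split: prod.split)
    also have "\<dots> = (\<Sum>i\<in>{1..m}. \<Sum>p\<in>P. if affine_mod N (fst p) (snd p) i \<in> S then 1 else 0)"
      by (rule sum.swap)
    also have "\<dots> = (\<Sum>i\<in>{1..m}. card {(c, d) \<in> P. affine_mod N c d i \<in> S})"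
      using finP by (intro sum.cong refl) (simp add: sum.If_cases Int_def case_prod_unfold)
    also have "\<dots> = (\<Sum>i\<in>{1..m}. N * card S)"
      unfolding P_def using SN N0 by (intro sum.cong refl card_affine_mod_point)
    finally show ?thesis by simp
  qed

  have sum_E: "(\<Sum>p\<in>P. card (E p)) \<le> m\<^sup>2 * card B"
  proof -
    let ?Q = "{(i, j) \<in> {1..m} \<times> {1..m}. i \<noteq> j}"
    have finQ: "finite ?Q" by (rule finite_subset[of _ "{1..m} \<times> {1..m}"]) auto
    have "(\<Sum>p\<in>P. card (E p)) = (\<Sum>p\<in>P. \<Sum>q\<in>?Q.
        if (affine_mod N (fst p) (snd p) (fst q), affine_mod N (fst p) (snd p) (snd q)) \<in> B then 1 else 0)"
      using finQ by (intro sum.cong refl)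
        (auto simp: E_def sum.If_cases case_prod_unfold intro!: arg_cong[of _ _ card])
    also have "\<dots> = (\<Sum>q\<in>?Q. \<Sum>p\<in>P.
        if (affine_mod N (fst p) (snd p) (fst q), affine_mod N (fst p) (snd p) (snd q)) \<in> B then 1 else 0)"
      by (rule sum.swap)
    also have "\<dots> = (\<Sum>q\<in>?Q. card {(c, d) \<in> P. (affine_mod N c d (fst q), affine_mod N c d (snd q)) \<in> B})"
      using finP by (intro sum.cong refl) (simp add: sum.If_cases Int_def case_prod_unfold)
    also have "\<dots> \<le> (\<Sum>q\<in>?Q. card B)"
      unfolding P_def
      by (intro sum_mono card_affine_mod_pair_le finB cop) auto
    also have "\<dots> \<le> m\<^sup>2 * card B"
    proof -
      have "card ?Q \<le> card ({1..m} \<times> {1..m})" by (intro card_mono) auto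
      then show ?thesis by (simp add: card_cartesian_product power2_eq_square)
    qed
    finally show ?thesis .
  qed

  \<comment> \<open>A lower bound for what survives the deletion, taken in the reals because it can
    be negative.\<close>
  define f where "f p = real (card (I p)) - card (E p)" for p
  have card_P: "real (card P) = real N * N" by (simp add: P_def card_cartesian_product)
  have "2 * \<theta> * m * card P \<le> sum f P"
  proof -
    have 1: "(real m)\<^sup>2 * card B \<le> real m * N * n * (\<epsilon> / 2)"
    proof -
      have "(real m)\<^sup>2 * card B \<le> (real m)\<^sup>2 * (6 * real K * n * h)"
        using card_B by (intro mult_left_mono) auto
      also have "\<dots> = real m * n * n * (\<epsilon> / 2)"
        using K1 m by (simp add: h_def field_simps power2_eq_square)
      also have "\<dots> \<le> real m * N * n * (\<epsilon> / 2)"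
        using nN \<epsilon> by (intro mult_right_mono mult_left_mono) auto
      finally show ?thesis .
    qed
    have "real m * N * (\<epsilon> * n) \<le> real m * N * card S"
      using S(2) by (intro mult_left_mono) auto
    also have "\<dots> = (\<Sum>p\<in>P. real (card (I p)))"
      using arg_cong[OF sum_I, of real] by simp
    finally have 2: "real m * N * (\<epsilon> * n) \<le> (\<Sum>p\<in>P. real (card (I p)))" .
    have 3: "(\<Sum>p\<in>P. real (card (E p))) \<le> (real m)\<^sup>2 * card B"
      using of_nat_mono[OF sum_E, where 'a = real] by simp
    have "2 * \<theta> * m * card P = real m * N * (\<epsilon> / 2) * (real N / (K + 2))"
      by (simp add: card_P \<theta>_def divide_simps)
    also have "\<dots> \<le> real m * N * (\<epsilon> / 2) * n"
    proof -
      have "real N \<le> real n * (K + 2)"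
        using of_nat_mono[OF N_le, where 'a = real] by (simp add: algebra_simps)
      then show ?thesis using \<epsilon> by (intro mult_left_mono) (auto simp: pos_divide_le_eq)
    qed
    also have "\<dots> \<le> sum f P"
      using 1 2 3 by (simp add: f_def sum_subtractf algebra_simps)
    finally show ?thesis .
  qed
  moreover have "f p \<le> m" for p
  proof -
    have "card (I p) \<le> card {1..m}"
      by (intro card_mono) (auto simp: I_def split: prod.split)
    then show ?thesis by (simp add: f_def)
  qed
  ultimately have large: "\<theta> * card P \<le> card {p \<in> P. \<theta> * m \<le> f p}"
    using finP m \<theta> by (intro card_large_values_ge) auto

  \<comment> \<open>The maps under which the images of \<open>i\<close> and \<open>j\<close> can
    give the value \<open>t\<close>, judged modulo \<open>N\<close>.\<close>
  define A where "A i j t = {(c, d) \<in> P. int N dvd t - ((a1 + a2) * int c + (a1 * int i + a2 * int j) * int d)}"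
    for i j t
  define W where "W = {(i, j, t). i \<in> {1..m} \<and> j \<in> {1..m} \<and> i \<noteq> j \<and> t \<in> T}"
  have W_sub: "W \<subseteq> {1..m} \<times> {1..m} \<times> T" by (auto simp: W_def)
  have finW: "finite W" by (rule finite_subset[OF W_sub]) (simp add: finT)
  have card_W: "card W \<le> m\<^sup>2 * card T"
    using card_mono[OF _ W_sub] finT by (simp add: card_cartesian_product power2_eq_square)

  have cover: "{p \<in> P. \<theta> * m \<le> f p} \<subseteq> (\<Union>(i, j, t)\<in>W. A i j t)"
  proof
    fix p assume p: "p \<in> {p \<in> P. \<theta> * m \<le> f p}"
    obtain c d where cd: "p = (c, d)" by fastforce
    define x where "x = affine_mod N c d"
    \<comment> \<open>Removing the first index of every bad pair leaves no bad pair inside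
      \<open>J\<close>.\<close>
    define J where "J = I p - fst ` E p"
    have finE: "finite (E p)"
      by (rule finite_subset[of _ "{1..m} \<times> {1..m}"]) (auto simp: E_def cd)
    have "card (I p) - card (E p) \<le> card J"
      using diff_card_le_card_Diff[of "fst ` E p" "I p"] card_image_le[OF finE, of fst] finE
      unfolding J_def by simp
    then have "f p \<le> card J" by (simp add: f_def)
    then have "\<theta> * m \<le> card J" using p by simp
    moreover have "J \<subseteq> {1..m}" by (auto simp: J_def I_def cd)
    \<comment> \<open>\<open>R_good\<close> is applied to the interval of length exactly
      \<open>m\<close>.\<close>
    ultimately have "has_distinct_sol a1 a2 a3 a4 J"
      using good unfolding R_good_def \<theta>_def by blast
    then obtain i1 i2 i3 i4 where i: "i1 \<in> J" "i2 \<in> J" "i3 \<in> J" "i4 \<in> J"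
      "i1 \<noteq> i2" "i3 \<noteq> i4" and sol: "is_sol a1 a2 a3 a4 i1 i2 i3 i4"
      unfolding has_distinct_sol_def by blast
    have xS: "x i \<in> S" and im: "i \<in> {1..m}" if "i \<in> J" for i
      using that by (auto simp: J_def I_def cd x_def)
    have xn: "x i \<le> n" if "i \<in> J" for i using xS[OF that] S by auto
    have notB: "(x i, x j) \<notin> B" if "i \<in> J" "j \<in> J" "i \<noteq> j" for i j
    proof
      assume "(x i, x j) \<in> B"
      then have "(i, j) \<in> E p" using that im by (simp add: E_def cd x_def)
      then show False using that by (force simp: J_def)
    qed
    define t where "t = a1 * int (x i1) + a2 * int (x i2)"
    let ?u = "a3 * int (x i3) + a4 * int (x i4)"
    have dvd_t: "int N dvd t - ((a1 + a2) * int c + (a1 * int i1 + a2 * int i2) * int d)"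
      unfolding t_def x_def by (rule dvd_linear_form_affine_mod)
    \<comment> \<open>By invariance, \<open>c\<close> and \<open>d\<close> drop out modulo
      \<open>N\<close>; a multiple of \<open>N\<close> of size at most \<open>K * n < N\<close> is
      zero.\<close>
    have "t + ?u = 0"
    proof -
      have "int N dvd (t - ((a1 + a2) * int c + (a1 * int i1 + a2 * int i2) * int d))
          + (?u - ((a3 + a4) * int c + (a3 * int i3 + a4 * int i4) * int d))"
        using dvd_t unfolding x_def by (intro dvd_add dvd_linear_form_affine_mod)
      also have "\<dots> = t + ?u - ((a1 + a2 + a3 + a4) * int c
          + (a1 * int i1 + a2 * int i2 + a3 * int i3 + a4 * int i4) * int d)"
        by (simp add: algebra_simps)
      also have "\<dots> = t + ?u" using sol sum0 by (simp add: is_sol_def)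
      finally have dvd: "int N dvd t + ?u" .
      have "\<bar>t + ?u\<bar> \<le> (\<bar>a1\<bar> + \<bar>a2\<bar>) * int n + (\<bar>a3\<bar> + \<bar>a4\<bar>) * int n"
        unfolding t_def
        by (rule order_trans[OF abs_triangle_ineq]) (intro add_mono abs_linear_form_le xn i)
      also have "\<dots> \<le> int K * int n"
        using mult_right_mono[OF K, of "int n"] by (simp add: algebra_simps)
      also have "\<dots> < int N" using Kn by (simp flip: of_nat_mult)
      finally have "\<not> \<bar>int N\<bar> \<le> \<bar>t + ?u\<bar>" by simp
      then show ?thesis using dvd_imp_le_int[OF _ dvd] by blast
    qed
    then have u: "?u = - t" by simp
    have "t \<in> T"
    proof -
      have "\<bar>t\<bar> \<le> (\<bar>a1\<bar> + \<bar>a2\<bar>) * int n"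
        unfolding t_def by (intro abs_linear_form_le xn i)
      also have "\<dots> \<le> int K * int n" using K by (intro mult_right_mono) auto
      finally have "\<bar>t\<bar> \<le> int K * int n" .
      moreover have "h \<le> card (pair_fibre a1 a2 S t)" "h \<le> card (pair_fibre a3 a4 S (- t))"
        using notB[of i1 i2] notB[of i3 i4] i xS u
        by (auto simp: B_def unpopular_pairs_def t_def not_less)
      ultimately show ?thesis by (auto simp: T_def)
    qed
    then have "(i1, i2, t) \<in> W" using i im by (auto simp: W_def)
    moreover have "p \<in> A i1 i2 t" using p dvd_t by (auto simp: A_def cd)
    ultimately show "p \<in> (\<Union>(i, j, t)\<in>W. A i j t)" by blast
  qed

  \<comment> \<open>If \<open>a1 + a2 = 0\<close>, the coefficient of \<open>d\<close> is
    \<open>a1 * (i - j)\<close>, a product of units; otherwise \<open>a1 + a2\<close> is itself a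
    unit.\<close>
  have card_A: "card (A i j t) \<le> N" if "(i, j, t) \<in> W" for i j t
    unfolding A_def P_def
  proof (rule card_linear_form_fibre_le)
    have ij: "i \<noteq> j" "i \<le> m" "j \<le> m" using that by (auto simp: W_def)
    show "coprime (a1 + a2) (int N) \<or> a1 + a2 = 0 \<and> coprime (a1 * int i + a2 * int j) (int N)"
    proof (cases "a1 + a2 = 0")
      case True
      then have "a1 * int i + a2 * int j = a1 * (int i - int j)"
        by (simp add: algebra_simps add_eq_0_iff2)
      moreover have "coprime a1 (int N)" "coprime (int i - int j) (int N)"
        using a1 K ij by (auto intro!: cop)
      ultimately show ?thesis using True by simp
    next
      case False
      then show ?thesis using K by (intro disjI1 cop) auto
    qed
  qed
  \<comment> \<open>The union bound over \<open>W\<close>, compared with \<open>large\<close>,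
    bounds \<open>card T\<close> from below.\<close>
  have "card {p \<in> P. \<theta> * m \<le> f p} \<le> card (\<Union>(i, j, t)\<in>W. A i j t)"
    by (intro card_mono[OF _ cover] finite_UN_I finW)
      (auto simp: A_def intro: finite_subset[OF _ finP])
  also have "\<dots> \<le> (\<Sum>w\<in>W. card (case w of (i, j, t) \<Rightarrow> A i j t))"
    by (rule card_UN_le[OF finW])
  also have "\<dots> \<le> (\<Sum>w\<in>W. N)"
    using card_A by (intro sum_mono) auto
  also have "\<dots> \<le> m\<^sup>2 * card T * N"
    using card_W by simp
  finally have "real (card {p \<in> P. \<theta> * m \<le> f p}) \<le> (real m)\<^sup>2 * card T * N"
    using of_nat_mono[where 'a = real] by fastforce
  then have "\<theta> * N * N \<le> (real m)\<^sup>2 * card T * N"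
    using large by (simp add: card_P algebra_simps)
  then have "\<theta> * N \<le> (real m)\<^sup>2 * card T"
    using N0 by simp
  then have "\<theta> * n \<le> (real m)\<^sup>2 * card T"
    using nN \<theta> by (meson less_imp_le mult_left_mono of_nat_mono order_trans)
  then have "\<theta> * n / m\<^sup>2 \<le> card T"
    using m by (simp add: pos_divide_le_eq mult.commute)
  then have "\<theta> * n / m\<^sup>2 * h\<^sup>2 \<le> card T * h\<^sup>2"
    by (intro mult_right_mono) auto
  also have "\<dots> \<le> card (sols a1 a2 a3 a4 S)"
    using h by (intro card_sols_ge finS finT) (auto simp: T_def)
  finally show ?thesis by (simp add: \<theta>_def h_def)
qed

section \<open>From sparsity to the density of solutions\<close>

lemma R_good_R_E:
  assumes "\<exists>R. R_good a1 a2 a3 a4 \<epsilon> R" "R_E a1 a2 a3 a4 \<epsilon> \<le> n"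
  shows "R_good a1 a2 a3 a4 \<epsilon> n"
proof -
  have "R_good a1 a2 a3 a4 \<epsilon> (R_E a1 a2 a3 a4 \<epsilon>)"
    unfolding R_E_def using assms(1) by (rule LeastI_ex)
  then show ?thesis using assms(2) unfolding R_good_def by (meson order_trans)
qed

text \<open>For \<open>C \<le> 1\<close>, sparsity at density \<open>1 / n\<close> would make
  \<open>n\<close> itself admissible, forcing a solution in distinct elements inside the singleton
  of 1.\<close>

lemma sparse_exponent_gt_1:
  fixes C \<epsilon>0 :: real
  assumes "0 < \<epsilon>0"
    and sparse: "\<And>\<epsilon>. 0 < \<epsilon> \<Longrightarrow> \<epsilon> \<le> \<epsilon>0 \<Longrightarrow>
      (\<exists>R. R_good a1 a2 a3 a4 \<epsilon> R) \<and> R_E a1 a2 a3 a4 \<epsilon> \<le> \<epsilon> powr (- C)"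
  shows "1 < C"
proof (rule ccontr)
  assume C: "\<not> 1 < C"
  obtain n :: nat where n: "1 / \<epsilon>0 < n" using reals_Archimedean2 by blast
  then have n0: "0 < real n" using assms(1) by (meson less_trans zero_less_divide_1_iff)
  then have n1: "1 \<le> real n" by simp
  have "1 / real n \<le> \<epsilon>0" using n n0 assms(1) by (simp add: field_simps)
  then have R: "\<exists>R. R_good a1 a2 a3 a4 (1 / real n) R"
    "R_E a1 a2 a3 a4 (1 / real n) \<le> (1 / real n) powr (- C)"
    using sparse[of "1 / real n"] n0 by auto
  have "(1 / real n) powr (- C) = real n powr C"
    using n0 by (simp add: powr_minus powr_divide)
  also have "\<dots> \<le> real n powr 1" using C n1 by (intro powr_mono) auto
  finally have "R_E a1 a2 a3 a4 (1 / real n) \<le> n" using R(2) n0 by simp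
  then have "R_good a1 a2 a3 a4 (1 / real n) n" using R(1) by (intro R_good_R_E)
  then have "has_distinct_sol a1 a2 a3 a4 {1}"
    unfolding R_good_def using n1 n0 by (auto dest!: spec[of _ n] spec[of _ "{1}"])
  then show False by (auto simp: has_distinct_sol_def)
qed

theorem theorem1:
  fixes a1 a2 a3 a4 :: int and C :: real
  assumes "a1 \<noteq> 0" "a2 \<noteq> 0" "a3 \<noteq> 0" "a4 \<noteq> 0"
    and "a1 + a2 + a3 + a4 = 0"
    and "C > 0"
    and "\<exists>\<epsilon>0>0. \<forall>\<epsilon>. 0 < \<epsilon> \<and> \<epsilon> \<le> \<epsilon>0 \<longrightarrow>
            (\<exists>R. R_good a1 a2 a3 a4 \<epsilon> R) \<and> real (R_E a1 a2 a3 a4 \<epsilon>) \<le> \<epsilon> powr (- C)"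
  shows "\<exists>\<epsilon>1>0. \<forall>\<epsilon>. 0 < \<epsilon> \<and> \<epsilon> \<le> \<epsilon>1 \<longrightarrow>
            R_star_E a1 a2 a3 a4 \<epsilon> \<ge> ereal (1/2 * \<epsilon> powr (8 * C))"
proof -
  obtain \<epsilon>0 where \<epsilon>0: "0 < \<epsilon>0" and sparse: "\<And>\<epsilon>. 0 < \<epsilon> \<Longrightarrow> \<epsilon> \<le> \<epsilon>0 \<Longrightarrow>
      (\<exists>R. R_good a1 a2 a3 a4 \<epsilon> R) \<and> real (R_E a1 a2 a3 a4 \<epsilon>) \<le> \<epsilon> powr (- C)"
    using assms(7) by blast
  have C1: "1 < C" using sparse_exponent_gt_1[OF \<epsilon>0 sparse] by blast
  define K where "K = nat (\<bar>a1\<bar> + \<bar>a2\<bar> + \<bar>a3\<bar> + \<bar>a4\<bar>)"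
  define L where "L = 4 * (real K + 2)"
  \<comment> \<open>The constant left after inserting the bound for \<open>m\<close>. Requiring
    \<open>\<epsilon> \<le> 2 * c\<close> lets one spare factor \<epsilon> absorb it.\<close>
  define c where "c = 1 / (144 * real K ^ 2 * L * L powr (4 * C))"
  have K: "\<bar>a1\<bar> + \<bar>a2\<bar> + \<bar>a3\<bar> + \<bar>a4\<bar> \<le> int K" by (simp add: K_def)
  have K0: "0 < real K" using assms(1) by (simp add: K_def)
  have L: "1 < L" by (simp add: L_def)
  have c: "0 < c" using K0 L by (simp add: c_def)
  have main: "ereal (1/2 * \<epsilon> powr (8 * C)) \<le> R_star_E a1 a2 a3 a4 \<epsilon>"
    if \<epsilon>: "0 < \<epsilon>" "\<epsilon> \<le> 1" "\<epsilon> \<le> \<epsilon>0" "\<epsilon> \<le> 2 * c" for \<epsilon>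
  proof -
    define \<delta> where "\<delta> = \<epsilon> / L"
    \<comment> \<open>Rounding down still leaves \<open>m\<close> at least \<open>R_E\<close>, which
      is a natural number.\<close>
    define m where "m = nat \<lfloor>\<delta> powr (- C)\<rfloor>"
    have "\<delta> \<le> \<epsilon>" using \<epsilon> L by (simp add: \<delta>_def field_simps)
    then have \<delta>: "0 < \<delta>" "\<delta> \<le> 1" "\<delta> \<le> \<epsilon>0" using \<epsilon> L by (auto simp: \<delta>_def)
    have "1 \<le> \<delta> powr (- C)"
      using powr_mono'[of "- C" 0 \<delta>] \<delta> C1 by simp
    then have m: "1 \<le> m" by (simp add: m_def le_nat_floor)
    have m_le: "real m \<le> \<delta> powr (- C)" by (simp add: m_def)
    have good: "R_good a1 a2 a3 a4 (\<epsilon> / (4 * (K + 2))) m"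
    proof -
      have "R_good a1 a2 a3 a4 \<delta> m"
        using sparse[OF \<delta>(1,3)] by (intro R_good_R_E) (auto simp: m_def le_nat_floor)
      then show ?thesis by (simp add: \<delta>_def L_def add.commute)
    qed
    have bound: "1/2 * \<epsilon> powr (8 * C) \<le> \<epsilon> ^ 3 / (144 * real K ^ 2 * L * real m ^ 4)"
    proof -
      have "real m ^ 4 \<le> (\<delta> powr (- C)) ^ 4" using m_le by (intro power_mono) auto
      also have "\<dots> = L powr (4 * C) / \<epsilon> powr (4 * C)"
        using \<epsilon> L by (simp add: \<delta>_def powr_power powr_divide powr_minus field_simps)
      finally have m4: "real m ^ 4 \<le> L powr (4 * C) / \<epsilon> powr (4 * C)" .
      \<comment> \<open>Here \<open>C > 1\<close> enters: \<open>4 + 4 * C \<le> 8 * C\<close>. The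
        summand 1 is the spare factor.\<close>
      have "\<epsilon> powr (8 * C) \<le> \<epsilon> powr (1 + (3 + 4 * C))"
        using \<epsilon> C1 by (intro powr_mono') auto
      also have "\<dots> = \<epsilon> * (\<epsilon> ^ 3 * \<epsilon> powr (4 * C))"
        using \<epsilon> by (simp add: powr_add eval_nat_numeral)
      also have "\<dots> \<le> 2 * c * (\<epsilon> ^ 3 * \<epsilon> powr (4 * C))"
        using \<epsilon> by (intro mult_right_mono) auto
      finally have "1/2 * \<epsilon> powr (8 * C) \<le> c * (\<epsilon> ^ 3 * \<epsilon> powr (4 * C))" by simp
      also have "\<dots> = \<epsilon> ^ 3 / (144 * real K ^ 2 * L * (L powr (4 * C) / \<epsilon> powr (4 * C)))"
        using \<epsilon> by (simp add: c_def)
      also have "\<dots> \<le> \<epsilon> ^ 3 / (144 * real K ^ 2 * L * real m ^ 4)"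
        using \<epsilon> L K0 m m4 by (intro divide_left_mono mult_left_mono mult_pos_pos) auto
      finally show ?thesis .
    qed
    have "1/2 * \<epsilon> powr (8 * C) \<le> min_sol_density a1 a2 a3 a4 \<epsilon> n" if n: "fact (m + K) \<le> n" for n
    proof -
      have n0: "0 < real n" using n fact_ge_1[of "m + K", where 'a = nat] by linarith
      have dens: "1/2 * \<epsilon> powr (8 * C) \<le> card (sols a1 a2 a3 a4 S) / real n ^ 3"
        if S: "S \<subseteq> {1..n}" "\<epsilon> * n \<le> card S" for S
      proof -
        have "\<epsilon> ^ 3 / (144 * real K ^ 2 * L * real m ^ 4) * real n ^ 3
            = \<epsilon> / L * n / m\<^sup>2 * (\<epsilon> * n / (12 * K * m))\<^sup>2"
          using m K0 L by (simp add: field_simps power2_eq_square power3_eq_cube power4_eq_xxxx)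
        also have "\<dots> \<le> card (sols a1 a2 a3 a4 S)"
          using card_sols_ge_of_R_good[OF assms(1,5) K \<epsilon>(1) m good n S]
          by (simp add: L_def add.commute)
        finally have "\<epsilon> ^ 3 / (144 * real K ^ 2 * L * real m ^ 4) \<le> card (sols a1 a2 a3 a4 S) / real n ^ 3"
          using n0 by (subst pos_le_divide_eq) auto
        with bound show ?thesis by (rule order_trans)
      qed
      have "finite {S. S \<subseteq> {1..n} \<and> \<epsilon> * real n \<le> real (card S)}"
        by (rule finite_subset[of _ "Pow {1..n}"]) auto
      \<comment> \<open>\<open>Min\<close> needs a nonempty family; the full interval belongs to it
        since \<open>\<epsilon> \<le> 1\<close>.\<close>
      moreover have "{1..n} \<in> {S. S \<subseteq> {1..n} \<and> \<epsilon> * real n \<le> real (card S)}"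
        using \<epsilon> n0 by simp
      ultimately show ?thesis
        unfolding min_sol_density_def using dens by (intro Min.boundedI) auto
    qed
    then show ?thesis
      unfolding R_star_E_def
      by (intro Liminf_bounded) (auto intro!: eventually_sequentiallyI[of "fact (m + K)"])
  qed
  then show ?thesis
    using \<epsilon>0 c by (intro exI[of _ "min 1 (min \<epsilon>0 (2 * c))"]) auto
qed

end
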